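(* Let $q$ be a prime power, let $d \ge 2$ be an integer and $k = d-1$. Let $\mathcal{F}$ be a finite family of at least two distinct linear cellular automata $F : \mathbb{F}_q^{2k} \to \mathbb{F}_q^{k}$ of length $2k$, each defined by a linear local rule of diameter $d$ whose first coefficient is nonzero and whose last coefficient is $1$. For $F\in\mathcal{F}$ with local rule $f$, let $P_f \in \mathbb{F}_q[X]$ be the polynomial associated to $f$. Then the minimum distance of the Grassmannian code $\mathcal{C}_{\mathcal{F}} = \{\ker(F) : F \in \mathcal{F}\}$ is $$D(\mathcal{C}_{\mathcal{F}}) = 2k - 2 \cdot \max_{F, G \in \mathcal{F},\, F \neq G} \deg(\gcd(P_f, P_g)),$$ where $P_f, P_g$ are the polynomials associated to the local rules of $F$ and $G$ respectively.
   Context: $\mathbb{F}_q$ is the finite field with $q$ elements. Let $d \le n$ be positive integers and $k=d-1$. A cellular automaton (CA) of length $n$, diameter $d$ and local rule $f:\mathbb{F}_q^d\to\mathbb{F}_q$ is the map $F:\mathbb{F}_q^n \to \mathbb{F}_q^{n-k}$ given by $F(x_0,\dots,x_{n-1})_i = f(x_i,\dots,x_{i+k})$ for $0\le i\le n-k-1$. The CA is linear if $f(x_0,\dots,x_k)=a_0x_0+\cdots+a_kx_k$ with $a_i\in\mathbb{F}_q$; the associated polynomial is $P_f(X)=a_0+a_1X+\cdots+a_kX^k$. Standing assumption: $a_0\neq 0$ and $a_k=1$ (so $P_f$ is monic of degree $k$ with nonzero constant term). Here $n=2k$. The distance between subspaces $A,B$ of $\mathbb{F}_q^n$ is $d(A,B)=\dim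 A+\dim B-2\dim(A\cap B)$. A subspace code is a set $\mathcal{C}$ of subspaces of $\mathbb{F}_q^n$; its minimum distance $D(\mathcal{C})$ is the minimum of $d(U,V)$ over distinct $U,V\in\mathcal{C}$. It is a Grassmannian code if all its elements have the same dimension. *)

theory Defs
  imports
    "Jordan_Normal_Form.VS_Connect"
    "HOL-Algebra.AbelCoset"
    "HOL-Computational_Algebra.Computational_Algebra"
begin

text \<open>
  The finite field is a type of class finite and field_gcd. The class field_gcd adds to field only
  the normalisation and Euclidean-division operations under which the library makes the polynomial
  ring an instance of its gcd classes; every field carries them. The space of vectors of length
  \<open>n\<close> is \<^term>\<open>carrier_vec n\<close>, with vector space structure \<^term>\<open>module_vec TYPE('a::field) n\<close>.
\<close>

subsection \<open>Cellular automata\<close>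

text \<open>
  A local rule of diameter \<open>d\<close> is a function on vectors of which only the values on
  \<^term>\<open>carrier_vec d\<close> matter. The automaton is restricted to \<^term>\<open>carrier_vec n\<close>, so that
  equality in HOL is equality of maps on vectors of length \<open>n\<close>.
\<close>

definition cellular_automaton :: "nat \<Rightarrow> nat \<Rightarrow> ('a vec \<Rightarrow> 'a) \<Rightarrow> 'a vec \<Rightarrow> 'a vec" where
  "cellular_automaton n d f =
     (\<lambda>x\<in>carrier_vec n. vec (n - (d - 1)) (\<lambda>i. f (vec d (\<lambda>j. x $ (i + j)))))"

definition linear_rule :: "'a::semiring_0 vec \<Rightarrow> 'a vec \<Rightarrow> 'a" where
  "linear_rule a x = (\<Sum>i<dim_vec a. a $ i * x $ i)"

definition admissible_coeffs :: "nat \<Rightarrow> 'a::zero_neq_one vec set" where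
  "admissible_coeffs d = {a \<in> carrier_vec d. a $ 0 \<noteq> 0 \<and> a $ (d - 1) = 1}"

definition associated_poly :: "'a::comm_monoid_add vec \<Rightarrow> 'a poly" where
  "associated_poly a = (\<Sum>i<dim_vec a. monom (a $ i) i)"

definition ca_kernel :: "nat \<Rightarrow> nat \<Rightarrow> ('a::field vec \<Rightarrow> 'a vec) \<Rightarrow> 'a vec set" where
  "ca_kernel n m F = a_kernel (module_vec TYPE('a) n) (module_vec TYPE('a) m) F"

subsection \<open>Subspace codes\<close>

definition subspace_dim :: "nat \<Rightarrow> 'a::field vec set \<Rightarrow> nat" where
  "subspace_dim n W = vectorspace.dim class_ring (module_vec TYPE('a) n\<lparr>carrier := W\<rparr>)"

definition subspace_distance :: "nat \<Rightarrow> 'a::field vec set \<Rightarrow> 'a vec set \<Rightarrow> int" where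
  "subspace_distance n A B =
     int (subspace_dim n A) + int (subspace_dim n B) - 2 * int (subspace_dim n (A \<inter> B))"

definition subspace_code :: "nat \<Rightarrow> 'a::field vec set set \<Rightarrow> bool" where
  "subspace_code n C \<longleftrightarrow> (\<forall>U\<in>C. VectorSpace.subspace class_ring U (module_vec TYPE('a) n))"

definition grassmannian_code :: "nat \<Rightarrow> 'a::field vec set set \<Rightarrow> bool" where
  "grassmannian_code n C \<longleftrightarrow>
     subspace_code n C \<and> (\<exists>m. \<forall>U\<in>C. subspace_dim n U = m)"

text \<open>
  Only meaningful for finite codes with at least two elements, since \<^const>\<open>Min\<close> is
  unspecified on the empty set.
\<close>

definition min_distance :: "nat \<Rightarrow> 'a::field vec set set \<Rightarrow> int" where
  "min_distance n C = Min {subspace_distance n U V | U V. U \<in> C \<and> V \<in> C \<and> U \<noteq> V}"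

end

theory Submission
  imports Defs
begin

text \<open>
  Pair a vector \<open>x\<close> of length \<open>n\<close> with a polynomial \<open>u\<close> of degree less than \<open>n\<close> by
  \<open>\<Sum>j<n. u\<^sub>j x\<^sub>j\<close>. The kernel of the automaton with polynomial \<open>p\<close> is the annihilator of the multiples
  of \<open>p\<close> of degree less than \<open>n\<close>, and its dimension is the degree of \<open>p\<close> since the automaton is
  surjective. When \<open>deg p + deg q \<le> n\<close>, every multiple of \<open>gcd p q\<close> of degree less than \<open>n\<close> is a sum of
  a multiple of \<open>p\<close> and a multiple of \<open>q\<close>, both of degree less than \<open>n\<close>: reduce the first Bezout
  coefficient modulo \<open>q\<close>. So the kernels of \<open>p\<close> and \<open>q\<close> meet in the annihilator of
  \<open>gcd p q\<close>, which has dimension \<open>deg (gcd p q)\<close>.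
\<close>

section \<open>Pairing of polynomials with vectors, and annihilators\<close>

definition poly_pairing :: "nat \<Rightarrow> 'a::comm_ring_1 poly \<Rightarrow> 'a vec \<Rightarrow> 'a" where
  "poly_pairing n u x = (\<Sum>j<n. coeff u j * x $ j)"

definition poly_annihilator :: "nat \<Rightarrow> 'a::field poly \<Rightarrow> 'a vec set" where
  "poly_annihilator n p =
     {x \<in> carrier_vec n. \<forall>u. p dvd u \<longrightarrow> degree u < n \<longrightarrow> poly_pairing n u x = 0}"

lemma poly_pairing_0 [simp]: "poly_pairing n 0 x = 0"
  by (simp add: poly_pairing_def)

lemma poly_pairing_add: "poly_pairing n (u + v) x = poly_pairing n u x + poly_pairing n v x"
  by (simp add: poly_pairing_def algebra_simps sum.distrib)

lemma poly_pairing_sum: "poly_pairing n (\<Sum>i\<in>I. f i) x = (\<Sum>i\<in>I. poly_pairing n (f i) x)"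
  by (induction I rule: infinite_finite_induct) (auto simp: poly_pairing_add)

text \<open>The shifted polynomial X^i p has coefficients only at positions i to i +
  \<open>degree p\<close>, so pairing with it reads a single window of \<open>x\<close>; the bound
  keeps that window inside the vector.\<close>

lemma poly_pairing_monom_mult:
  assumes "i + degree p < n"
  shows "poly_pairing n (monom c i * p) x = c * (\<Sum>j\<le>degree p. coeff p j * x $ (i + j))"
proof -
  have "(\<Sum>j<n. coeff (monom c i * p) j * x $ j)
      = (\<Sum>j\<in>{i..i + degree p}. coeff (monom c i * p) j * x $ j)"
    using assms
    by (intro sum.mono_neutral_right) (auto simp: coeff_monom_mult coeff_eq_0)
  also have "\<dots> = (\<Sum>j\<in>{0..degree p}. coeff (monom c i * p) (i + j) * x $ (i + j))"
    using sum.shift_bounds_cl_nat_ivl[of "\<lambda>j. coeff (monom c i * p) j * x $ j" 0 i "degree p"]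
    by (simp add: add.commute)
  finally show ?thesis
    by (simp add: poly_pairing_def coeff_monom_mult sum_distrib_left mult.assoc atMost_atLeast0)
qed

text \<open>The shifts X^i p with i + \<open>degree p\<close> < n span the multiples of
  \<open>p\<close> of degree below \<open>n\<close>, so testing these shifts suffices. Each test is
  one output of the automaton.\<close>

lemma poly_annihilator_iff:
  fixes p :: "'a::field poly"
  assumes "p \<noteq> 0"
  shows "x \<in> poly_annihilator n p \<longleftrightarrow>
    x \<in> carrier_vec n \<and> (\<forall>i<n - degree p. (\<Sum>j\<le>degree p. coeff p j * x $ (i + j)) = 0)"
    (is "_ \<longleftrightarrow> _ \<and> ?R")
proof -
  have "(\<forall>u. p dvd u \<longrightarrow> degree u < n \<longrightarrow> poly_pairing n u x = 0) \<longleftrightarrow> ?R"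
  proof (intro iffI allI impI)
    fix i
    assume *: "\<forall>u. p dvd u \<longrightarrow> degree u < n \<longrightarrow> poly_pairing n u x = 0" and i: "i < n - degree p"
    then have "poly_pairing n (monom 1 i * p) x = 0"
      using assms by (simp add: degree_mult_eq degree_monom_eq)
    then show "(\<Sum>j\<le>degree p. coeff p j * x $ (i + j)) = 0"
      using i by (subst (asm) poly_pairing_monom_mult) auto
  next
    fix u
    assume R: ?R and "p dvd u" and deg: "degree u < n"
    then obtain w where u: "u = w * p"
      by (metis dvd_def mult.commute)
    show "poly_pairing n u x = 0"
    proof (cases "w = 0")
      case False
      then have "degree w + degree p < n"
        using assms deg u by (simp add: degree_mult_eq)
      \<comment> \<open>Expanding \<open>w\<close> in monomials writes \<open>u\<close> as a
        combination of shifts of \<open>p\<close>; since \<open>degree w + degree p < n\<close>,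
        every shift that occurs has its window inside the vector.\<close>
      then have "poly_pairing n (monom (coeff w i) i * p) x = 0" if "i \<le> degree w" for i
        using R that by (subst poly_pairing_monom_mult) auto
      moreover have "u = (\<Sum>i\<le>degree w. monom (coeff w i) i * p)"
        by (simp add: u poly_as_sum_of_monoms flip: sum_distrib_right)
      ultimately show ?thesis
        by (simp add: poly_pairing_sum)
    qed (simp add: u)
  qed
  then show ?thesis
    by (auto simp: poly_annihilator_def)
qed

section \<open>Intersection of two annihilators\<close>

lemma poly_annihilator_Int:
  fixes p q :: "'a::field_gcd poly"
  assumes "q \<noteq> 0" and "degree p + degree q \<le> n"
  shows "poly_annihilator n p \<inter> poly_annihilator n q = poly_annihilator n (gcd p q)"
proof (intro equalityI subsetI)
  fix x
  assume "x \<in> poly_annihilator n (gcd p q)"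
  then show "x \<in> poly_annihilator n p \<inter> poly_annihilator n q"
    by (auto simp: poly_annihilator_def dest: dvd_trans[OF gcd_dvd1] dvd_trans[OF gcd_dvd2])
next
  fix x
  assume x: "x \<in> poly_annihilator n p \<inter> poly_annihilator n q"
  have "poly_pairing n u x = 0" if dvd: "gcd p q dvd u" and deg: "degree u < n" for u
  proof -
    obtain w where w: "u = gcd p q * w"
      using dvd by (rule Rings.dvdE)
    define a b where "a = w * fst (bezout_coefficients p q)"
      and "b = w * snd (bezout_coefficients p q)"
    then have ab: "u = a * p + b * q"
      by (simp add: w algebra_simps flip: bezout_coefficients_fst_snd[of p q])
    \<comment> \<open>Replacing \<open>a\<close> by its remainder modulo \<open>q\<close> moves a
      multiple of \<open>p * q\<close> from the first summand to the second, so \<open>u - v\<close>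
      is still a multiple of \<open>q\<close>.\<close>
    define v where "v = p * (a mod q)"
    have "degree v < n"
    \<comment> \<open>A nonzero remainder has degree below \<open>degree q\<close>, so the degree of
      \<open>v\<close> is below \<open>degree p + degree q\<close>, which is at most
      \<open>n\<close>. If the remainder is zero, then \<open>v = 0\<close>, and
      \<open>degree u < n\<close> supplies 0 < n.\<close>
    proof (cases "a mod q = 0")
      case False
      then have "degree (a mod q) < degree q"
        using assms(1) degree_mod_less by blast
      then show ?thesis
        unfolding v_def using assms(2) degree_mult_le[of p "a mod q"] by linarith
    qed (use deg in \<open>simp add: v_def\<close>)
    moreover have "p dvd v"
      by (simp add: v_def)
    moreover have "u - v = q * (b + p * (a div q))"
    proof -
      have "u - v = p * (a - a mod q) + b * q"
        by (simp add: ab v_def algebra_simps)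
      then show ?thesis
        by (simp add: minus_mod_eq_div_mult algebra_simps)
    qed
    ultimately have "poly_pairing n v x = 0" "poly_pairing n (u - v) x = 0"
      using x deg degree_diff_less[of u n v] by (auto simp: poly_annihilator_def)
    then show ?thesis
      using poly_pairing_add[of n v "u - v" x] by simp
  qed
  then show "x \<in> poly_annihilator n (gcd p q)"
    using x by (auto simp: poly_annihilator_def)
qed

section \<open>Surjectivity and dimension\<close>

text \<open>The leading coefficient is invertible, so each new equation can be solved for the last
  entry of its window. This gives surjectivity of the automaton.\<close>

lemma linear_recurrence_solvable:
  fixes p :: "'a::field poly"
  assumes "p \<noteq> 0"
  shows "\<exists>x. \<forall>i<m. (\<Sum>j\<le>degree p. coeff p j * x (i + j)) = y i"
proof (induction m)
  case (Suc m)
  then obtain x where x: "\<And>i. i < m \<Longrightarrow> (\<Sum>j\<le>degree p. coeff p j * x (i + j)) = y i"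
    by blast
  \<comment> \<open>Only entry \<open>m + degree p\<close> changes. The equations before
    \<open>m\<close> read smaller indices and survive; the new value is the one that solves equation
    \<open>m\<close>.\<close>
  define z where
    "z = x(m + degree p := (y m - (\<Sum>j<degree p. coeff p j * x (m + j))) / lead_coeff p)"
  have "(\<Sum>j\<le>degree p. coeff p j * z (i + j)) = y i" if "i < m" for i
  proof -
    have "(\<Sum>j\<le>degree p. coeff p j * z (i + j)) = (\<Sum>j\<le>degree p. coeff p j * x (i + j))"
      using that by (intro sum.cong) (auto simp: z_def)
    then show ?thesis
      using x that by simp
  qed
  moreover have "(\<Sum>j\<le>degree p. coeff p j * z (m + j)) = y m"
  proof -
    have "(\<Sum>j<degree p. coeff p j * z (m + j)) = (\<Sum>j<degree p. coeff p j * x (m + j))"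
      by (intro sum.cong) (auto simp: z_def)
    then show ?thesis
      using assms by (simp add: z_def flip: lessThan_Suc_atMost)
  qed
  ultimately show ?case
    by (metis less_Suc_eq)
qed simp

text \<open>The annihilator is the kernel of the linear map \<open>T\<close> of window sums. This
  map is onto a space of dimension \<open>n - degree p\<close>, so rank-nullity leaves dimension
  \<open>degree p\<close> for the kernel.\<close>

lemma
  fixes p :: "'a::field poly"
  assumes "p \<noteq> 0" and "degree p \<le> n"
  shows subspace_poly_annihilator:
      "VectorSpace.subspace class_ring (poly_annihilator n p) (module_vec TYPE('a) n)"
    and subspace_dim_poly_annihilator: "subspace_dim n (poly_annihilator n p) = degree p"
proof -
  let ?m = "n - degree p"
  let ?V = "module_vec TYPE('a) n" and ?W = "module_vec TYPE('a) ?m"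
  define T where "T x = vec ?m (\<lambda>i. \<Sum>j\<le>degree p. coeff p j * x $ (i + j))" for x :: "'a vec"
  interpret V: vec_space "TYPE('a)" n .
  interpret W: vec_space "TYPE('a)" ?m .
  have "linear_map class_ring ?V ?W T"
  proof (intro linear_map.intro mod_hom.intro mod_hom_axioms.intro vec_vs vec_module)
    show "T \<in> LinearCombinations.module_hom class_ring ?V ?W"
      unfolding LinearCombinations.module_hom_def using assms(2)
      by (auto simp: T_def module_vec_simps algebra_simps sum.distrib sum_distrib_left
          intro!: eq_vecI)
  qed
  then interpret T: linear_map class_ring ?V ?W T .
  have ker: "T.kerT = poly_annihilator n p"
    using poly_annihilator_iff[OF assms(1), of _ n]
    by (auto simp: T.ker_def T_def module_vec_simps vec_eq_iff)
  show "VectorSpace.subspace class_ring (poly_annihilator n p) ?V"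
    using T.kerT_is_subspace by (simp add: ker)
  have "y \<in> T ` carrier_vec n" if y: "y \<in> carrier_vec ?m" for y
  proof -
    obtain x where "\<And>i. i < ?m \<Longrightarrow> (\<Sum>j\<le>degree p. coeff p j * x (i + j)) = y $ i"
      using linear_recurrence_solvable[OF assms(1), of ?m "($) y"] by blast
    \<comment> \<open>Truncating the sequence at length \<open>n\<close> loses nothing: for i <
      \<open>n - degree p\<close> every window stays below index \<open>n\<close>.\<close>
    then have "y = T (vec n x)"
      using y assms(2) by (auto simp: T_def intro!: eq_vecI)
    then show ?thesis
      by simp
  qed
  then have im: "T.imT = carrier ?W"
    using T.T_im by (auto simp: T.im_def module_vec_simps)
  have "?W\<lparr>carrier := carrier ?W\<rparr> = ?W"
    by simp
  then have "vectorspace.dim class_ring ?W + subspace_dim n (poly_annihilator n p) = n"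
    using T.rank_nullity[OF V.fin_dim] V.dim_is_n unfolding im ker subspace_dim_def by metis
  then show "subspace_dim n (poly_annihilator n p) = degree p"
    using W.dim_is_n assms(2) by simp
qed

section \<open>Associated polynomials and kernels of automata\<close>

lemma coeff_associated_poly:
  "coeff (associated_poly a) i = (if i < dim_vec a then a $ i else 0)"
  by (simp add: associated_poly_def coeff_sum)

lemma associated_poly_inject:
  assumes "dim_vec a = dim_vec b"
  shows "associated_poly a = associated_poly b \<longleftrightarrow> a = b"
  using assms by (auto simp: poly_eq_iff coeff_associated_poly vec_eq_iff)

lemma
  assumes "a \<in> admissible_coeffs (Suc k)"
  shows degree_associated_poly: "degree (associated_poly a) = k"
    and lead_coeff_associated_poly: "lead_coeff (associated_poly a) = 1"
proof -
  have "coeff (associated_poly a) k = 1" "\<And>i. i > k \<Longrightarrow> coeff (associated_poly a) i = 0"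
    using assms by (auto simp: admissible_coeffs_def coeff_associated_poly)
  then show "degree (associated_poly a) = k"
    by (metis degree_le le_degree order_antisym zero_neq_one)
  then show "lead_coeff (associated_poly a) = 1"
    using \<open>coeff (associated_poly a) k = 1\<close> by simp
qed

text \<open>Since the associated polynomial has degree \<open>k\<close>, the \<open>n - k\<close>
  outputs of the automaton are exactly the window sums of
  \<open>poly_annihilator_iff\<close>.\<close>

lemma ca_kernel_linear_rule:
  fixes a :: "'a::field vec"
  assumes "a \<in> admissible_coeffs (Suc k)"
  shows "ca_kernel n (n - k) (cellular_automaton n (Suc k) (linear_rule a))
    = poly_annihilator n (associated_poly a)"
proof (intro Set.set_eqI)
  fix x
  have nz: "associated_poly a \<noteq> 0"
    using lead_coeff_associated_poly[OF assms] by auto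
  have dim: "dim_vec a = Suc k"
    using assms by (auto simp: admissible_coeffs_def)
  show "x \<in> ca_kernel n (n - k) (cellular_automaton n (Suc k) (linear_rule a))
    \<longleftrightarrow> x \<in> poly_annihilator n (associated_poly a)"
    unfolding poly_annihilator_iff[OF nz] degree_associated_poly[OF assms]
    by (auto simp: ca_kernel_def a_kernel_def' cellular_automaton_def linear_rule_def
        coeff_associated_poly dim module_vec_simps vec_eq_iff
        simp flip: lessThan_Suc_atMost)
qed

section \<open>Greatest common divisors of distinct monic polynomials\<close>

text \<open>A gcd of full degree would differ from \<open>p\<close> and from \<open>q\<close> only
  by unit factors. Then \<open>p\<close> divides \<open>q\<close> with a constant cofactor, which is
  1 because both are monic.\<close>

lemma degree_gcd_less:
  fixes p q :: "'a::field_gcd poly"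
  assumes "lead_coeff p = 1" "lead_coeff q = 1" "degree p = degree q" "p \<noteq> q"
  shows "degree (gcd p q) < degree p"
proof (rule ccontr)
  assume "\<not> degree (gcd p q) < degree p"
  have nz: "p \<noteq> 0" "q \<noteq> 0"
    using assms by auto
  have "r dvd gcd p q" if "r \<in> {p, q}" for r
  proof -
    have "gcd p q dvd r" "r \<noteq> 0" "degree r = degree p"
      using that nz assms(3) by auto
    then obtain w where w: "r = gcd p q * w"
      by (elim Rings.dvdE)
    then have "gcd p q \<noteq> 0" "w \<noteq> 0"
      using \<open>r \<noteq> 0\<close> by auto
    then have "degree w = 0"
      using w \<open>degree r = degree p\<close> \<open>\<not> degree (gcd p q) < degree p\<close>
      by (simp add: degree_mult_eq)
    then have "is_unit w"
      using \<open>w \<noteq> 0\<close> by (simp add: is_unit_iff_degree)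
    then show ?thesis
      by (simp add: w mult_unit_dvd_iff)
  qed
  then have "p dvd q" "q dvd p"
    using dvd_trans gcd_dvd1 gcd_dvd2 by blast+
  then obtain w where w: "q = p * w"
    by (elim Rings.dvdE)
  then have "degree q = degree p + degree w"
    using nz by (metis degree_mult_eq mult_zero_right)
  moreover have "lead_coeff w = 1"
    using w assms(1,2) by (metis lead_coeff_mult mult_1)
  ultimately have "w = 1"
    using assms(3) by (auto elim: degree_eq_zeroE simp: one_pCons)
  then show False
    using w assms(4) by simp
qed

section \<open>Minimum distance of the code of kernels\<close>

theorem theorem1:
  fixes d k :: nat
    and \<F> :: "('a::{finite, field_gcd} vec \<Rightarrow> 'a vec) set"
    and coeffs_of :: "('a vec \<Rightarrow> 'a vec) \<Rightarrow> 'a vec"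
  assumes "d \<ge> 2" and "k = d - 1"
    and "finite \<F>" and "card \<F> \<ge> 2"
    and "\<And>F. F \<in> \<F> \<Longrightarrow> coeffs_of F \<in> admissible_coeffs d
           \<and> F = cellular_automaton (2 * k) d (linear_rule (coeffs_of F))"
  shows "grassmannian_code (2 * k) (ca_kernel (2 * k) k ` \<F>)
    \<and> min_distance (2 * k) (ca_kernel (2 * k) k ` \<F>)
      = 2 * int k - 2 * int (Max {degree (gcd (associated_poly (coeffs_of F))
                                              (associated_poly (coeffs_of G))) | F G.
                                    F \<in> \<F> \<and> G \<in> \<F> \<and> F \<noteq> G})"
proof
  define P where "P F = associated_poly (coeffs_of F)" for F
  define K where "K = (ca_kernel (2 * k) k :: ('a vec \<Rightarrow> 'a vec) \<Rightarrow> 'a vec set)"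
  define M where "M = {degree (gcd (P F) (P G)) | F G. F \<in> \<F> \<and> G \<in> \<F> \<and> F \<noteq> G}"
  have d: "d = Suc k"
    using assms(1,2) by simp
  have adm: "coeffs_of F \<in> admissible_coeffs (Suc k)"
    and F_eq: "F = cellular_automaton (2 * k) (Suc k) (linear_rule (coeffs_of F))"
    if "F \<in> \<F>" for F
    using assms(5)[OF that] d by simp_all
  have deg: "degree (P F) = k" and monic: "lead_coeff (P F) = 1" if "F \<in> \<F>" for F
    using adm[OF that] unfolding P_def
    by (rule degree_associated_poly, rule lead_coeff_associated_poly)
  have nz: "P F \<noteq> 0" if "F \<in> \<F>" for F
    using monic[OF that] by auto
  \<comment> \<open>The coefficients determine the automaton, and for vectors of equal length the
    polynomial determines the coefficients.\<close>
  have P_inj: "P F \<noteq> P G" if "F \<in> \<F>" "G \<in> \<F>" "F \<noteq> G" for F G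
  proof
    assume "P F = P G"
    moreover have "dim_vec (coeffs_of F) = dim_vec (coeffs_of G)"
      using adm[OF that(1)] adm[OF that(2)] by (auto simp: admissible_coeffs_def)
    ultimately have "coeffs_of F = coeffs_of G"
      by (simp add: P_def associated_poly_inject)
    then show False
      using that(3) F_eq[OF that(1)] F_eq[OF that(2)] by metis
  qed
  have K_eq: "K F = poly_annihilator (2 * k) (P F)" if "F \<in> \<F>" for F
    using ca_kernel_linear_rule[OF adm[OF that], of "2 * k"]
    unfolding K_def P_def F_eq[OF that, symmetric] by simp
  have dim_K: "subspace_dim (2 * k) (K F) = k" if "F \<in> \<F>" for F
    using subspace_dim_poly_annihilator[OF nz[OF that]] by (simp add: K_eq deg that)
  have dim_Int: "subspace_dim (2 * k) (K F \<inter> K G) = degree (gcd (P F) (P G))"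
    and deg_gcd: "degree (gcd (P F) (P G)) < k"
    if "F \<in> \<F>" "G \<in> \<F>" "F \<noteq> G" for F G
  proof -
    show less: "degree (gcd (P F) (P G)) < k"
      using degree_gcd_less[OF monic monic _ P_inj] that by (simp add: deg)
    \<comment> \<open>Length \<open>2 * k\<close> is the sum of the degrees of \<open>P F\<close>
      and \<open>P G\<close>, so the bound in \<open>poly_annihilator_Int\<close> holds with
      equality.\<close>
    show "subspace_dim (2 * k) (K F \<inter> K G) = degree (gcd (P F) (P G))"
      using that less nz
      by (simp add: K_eq poly_annihilator_Int deg subspace_dim_poly_annihilator)
  qed
  \<comment> \<open>Equal kernels would coincide with their intersection, whose dimension is below
    \<open>k\<close>. Hence pairs of distinct codewords correspond to pairs of distinct
    automata.\<close>
  have K_inj: "K F \<noteq> K G" if "F \<in> \<F>" "G \<in> \<F>" "F \<noteq> G" for F G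
    using dim_Int[OF that] deg_gcd[OF that] dim_K[OF that(1)] by auto
  have "VectorSpace.subspace class_ring (K F) (module_vec TYPE('a) (2 * k))" if "F \<in> \<F>" for F
    using subspace_poly_annihilator[OF nz[OF that]] by (simp add: K_eq deg that)
  then show "grassmannian_code (2 * k) (ca_kernel (2 * k) k ` \<F>)"
    using dim_K by (auto simp: grassmannian_code_def subspace_code_def simp flip: K_def)
  have dist: "subspace_distance (2 * k) (K F) (K G) = 2 * int k - 2 * int (degree (gcd (P F) (P G)))"
    if "F \<in> \<F>" "G \<in> \<F>" "F \<noteq> G" for F G
    using that by (simp add: subspace_distance_def dim_K dim_Int)
  have "{subspace_distance (2 * k) U V | U V. U \<in> K ` \<F> \<and> V \<in> K ` \<F> \<and> U \<noteq> V}
      = (\<lambda>m. 2 * int k - 2 * int m) ` M" (is "?D = _")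
  proof (intro Set.equalityI subsetI)
    fix m
    assume "m \<in> ?D"
    then obtain F G where "F \<in> \<F>" "G \<in> \<F>" "K F \<noteq> K G"
      and m: "m = subspace_distance (2 * k) (K F) (K G)"
      by (elim CollectE exE conjE imageE) simp
    then have FG: "F \<in> \<F>" "G \<in> \<F>" "F \<noteq> G"
      by auto
    then have "degree (gcd (P F) (P G)) \<in> M"
      unfolding M_def by blast
    then show "m \<in> (\<lambda>m. 2 * int k - 2 * int m) ` M"
      unfolding m dist[OF FG] by (rule imageI)
  next
    fix m
    assume "m \<in> (\<lambda>m. 2 * int k - 2 * int m) ` M"
    then obtain F G where FG: "F \<in> \<F>" "G \<in> \<F>" "F \<noteq> G"
      and "m = 2 * int k - 2 * int (degree (gcd (P F) (P G)))"
      unfolding M_def by (elim CollectE exE conjE imageE) simp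
    then have "m = subspace_distance (2 * k) (K F) (K G)"
      by (simp add: dist)
    then show "m \<in> ?D"
      using FG K_inj[OF FG] by (intro CollectI exI conjI) auto
  qed
  then have "min_distance (2 * k) (K ` \<F>) = Min ((\<lambda>m. 2 * int k - 2 * int m) ` M)"
    by (simp add: min_distance_def)
  \<comment> \<open>The distance decreases as the gcd degree grows, so the minimum is attained at
    \<open>Max M\<close>. The set \<open>M\<close> is finite because its elements lie below
    \<open>k\<close>, and nonempty because the family has two distinct members.\<close>
  also have "\<dots> = 2 * int k - 2 * int (Max M)"
  proof -
    have "M \<subseteq> {..<k}"
      using deg_gcd by (auto simp: M_def)
    then have fin: "finite M"
      by (rule finite_subset) simp
    have "\<not> card \<F> \<le> Suc 0"
      using assms(4) by simp
    then obtain F G where "F \<in> \<F>" "G \<in> \<F>" "F \<noteq> G"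
      using card_le_Suc0_iff_eq[OF assms(3)] by auto
    then have "M \<noteq> {}"
      by (auto simp: M_def)
    then show ?thesis
      using fin by (intro Min_eqI) auto
  qed
  finally show "min_distance (2 * k) (ca_kernel (2 * k) k ` \<F>)
      = 2 * int k - 2 * int (Max {degree (gcd (associated_poly (coeffs_of F))
                                              (associated_poly (coeffs_of G))) | F G.
                                    F \<in> \<F> \<and> G \<in> \<F> \<and> F \<noteq> G})"
    by (simp add: K_def M_def P_def)
qed

end
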